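(* Let $\rho^*$ be any smooth, positive probability density on $\mathbb R^d$ ($d\ge1$) and let $\epsilon>0$. Then there exists a smooth, positive probability density $\rho$ on $\mathbb R^d$ with $\rho\ne\rho^*$ such that $$\int\rho\Bigl(\log\frac{\rho}{\rho^*}-\mathrm{KL}[\rho\Vert\rho^*]\Bigr)^2d\theta\le\epsilon\,\mathrm{KL}[\rho\Vert\rho^*].$$ Moreover, given any $\epsilon'>0$, such a $\rho$ (with $\rho\neq\rho^*$ and satisfying $\int\rho\bigl(\log\frac{\rho}{\rho^*}-\mathrm{KL}[\rho\Vert\rho^*]\bigr)^2d\theta\le\epsilon\,\mathrm{KL}[\rho\Vert\rho^*]$) can also be chosen in the neighborhood of $\rho^*$ defined by $\mathrm{KL}[\rho\Vert\rho^*]<\epsilon'$.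
   Context: $\mathrm{KL}[\rho\Vert\rho^*]=\int\rho\log\frac{\rho}{\rho^*}\,d\theta$. *)

theory Defs
  imports "HOL-Probability.Probability"
begin

text \<open>
  Differentiability classes on the whole space: a function is of class \<open>C\<^sup>k\<^sup>+\<^sup>1\<close> iff it is
  Frechet differentiable everywhere and each of its directional derivatives is of class
  \<open>C\<^sup>k\<close>. On a Euclidean space this is the usual notion in terms of continuous partial
  derivatives.
\<close>

primrec C_k :: "nat \<Rightarrow> ('a::real_normed_vector \<Rightarrow> real) \<Rightarrow> bool" where
  "C_k 0 f \<longleftrightarrow> continuous_on UNIV f"
| "C_k (Suc k) f \<longleftrightarrow>
     (\<forall>x. f differentiable (at x)) \<and> (\<forall>v. C_k k (\<lambda>x. frechet_derivative f (at x) v))"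

definition smooth :: "('a::real_normed_vector \<Rightarrow> real) \<Rightarrow> bool" where
  "smooth f \<longleftrightarrow> (\<forall>k. C_k k f)"

definition smooth_pos_density :: "('a::euclidean_space \<Rightarrow> real) \<Rightarrow> bool" where
  "smooth_pos_density \<rho> \<longleftrightarrow>
     smooth \<rho> \<and> (\<forall>x. 0 < \<rho> x) \<and> has_bochner_integral lborel \<rho> 1"

text \<open>
  The Bochner integral is \<open>0\<close> for a non-integrable integrand, so \<open>KL\<close> is the
  divergence only when \<open>\<rho> log (\<rho> / \<rho>')\<close> is integrable; integrability has to be stated
  wherever a finite divergence is meant.
\<close>

definition KL :: "('a::euclidean_space \<Rightarrow> real) \<Rightarrow> ('a \<Rightarrow> real) \<Rightarrow> real" where
  "KL \<rho> \<rho>' = (\<integral>\<theta>. \<rho> \<theta> * ln (\<rho> \<theta> / \<rho>' \<theta>) \<partial>lborel)"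

lemma KL_eq_KL_divergence:
  assumes "smooth_pos_density \<rho>" "smooth_pos_density \<rho>'"
  shows "KL \<rho> \<rho>' = KL_divergence (exp 1) (density lborel \<rho>') (density lborel \<rho>)"
proof -
  have *: "f \<in> borel_measurable lborel" "\<And>x. 0 < f x"
    if "smooth_pos_density f" for f :: "'a \<Rightarrow> real"
    using that by (auto simp: smooth_pos_density_def has_bochner_integral_iff)
  show ?thesis
    unfolding KL_def
    using *[OF assms(1)] *[OF assms(2)]
    by (subst lborel.KL_density_density) (auto simp: less_imp_le less_imp_neq[symmetric] log_def)
qed

end

theory Submission
  imports Defs "HOL-Real_Asymp.Real_Asymp"
begin

text \<open>
  Conditioning \<open>\<rho>s\<close> on a half-space \<open>{x. x \<bullet> e < t}\<close> of probability \<open>P < 1\<close> makes the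
  log-ratio constant, with \<open>KL = - ln P > 0\<close> and variance \<open>0\<close>; moreover \<open>P\<close> tends to \<open>1\<close> as
  \<open>t\<close> grows. The indicator of the half-space is the pointwise limit of the smooth positive
  logistic functions \<open>\<phi>\<^sub>n\<close>. Since \<open>y ln y\<close> and \<open>y (ln y)\<^sup>2\<close> are bounded on \<open>(0, 1]\<close> and vanish at
  both ends, dominated convergence shows that \<open>\<rho>s \<phi>\<^sub>n\<close>, normalised, has divergence tending to
  \<open>- ln P\<close> and variance tending to \<open>0\<close>.
\<close>

section \<open>Closure of the differentiability classes under sums and products\<close>

lemma C_k_const: "C_k k (\<lambda>x. c)"
proof (induction k arbitrary: c)
  case (Suc k)
  have "frechet_derivative (\<lambda>x::'a. c) (at x) = (\<lambda>v. 0)" for x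
    by (rule frechet_derivative_at[symmetric]) simp
  with Suc show ?case by simp
qed simp

text \<open>At the bottom level this is continuity of differentiable functions; above it, the
  induction applies to each directional derivative. The product rule needs this, because it keeps
  one factor undifferentiated.\<close>

lemma C_k_SucD: "C_k (Suc k) f \<Longrightarrow> C_k k f"
proof (induction k arbitrary: f)
  case 0
  then show ?case
    by (auto intro: continuous_at_imp_continuous_on differentiable_imp_continuous_within)
next
  case (Suc k)
  then show ?case by (metis C_k.simps(2))
qed

lemma C_k_add:
  assumes "C_k k f" "C_k k g"
  shows "C_k k (\<lambda>x. f x + g x)"
  using assms
proof (induction k arbitrary: f g)
  case 0
  then show ?case by (auto intro: continuous_intros)
next
  case (Suc k)
  then have d: "f differentiable (at x)" "g differentiable (at x)" for x by auto
  have "frechet_derivative (\<lambda>x. f x + g x) (at x)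
      = (\<lambda>v. frechet_derivative f (at x) v + frechet_derivative g (at x) v)" for x
    by (rule frechet_derivative_at[symmetric])
      (intro has_derivative_add d[unfolded frechet_derivative_works])
  with Suc d show ?case by auto
qed

lemma C_k_mult:
  assumes "C_k k f" "C_k k g"
  shows "C_k k (\<lambda>x. f x * g x)"
  using assms
proof (induction k arbitrary: f g)
  case 0
  then show ?case by (auto intro: continuous_intros)
next
  case (Suc k)
  then have d: "f differentiable (at x)" "g differentiable (at x)" for x by auto
  have "frechet_derivative (\<lambda>x. f x * g x) (at x)
      = (\<lambda>v. f x * frechet_derivative g (at x) v + frechet_derivative f (at x) v * g x)" for x
    by (rule frechet_derivative_at[symmetric])
      (intro has_derivative_mult d[unfolded frechet_derivative_works])
  \<comment> \<open>The undifferentiated factors must be lowered to level \<open>k\<close> before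
    the induction hypothesis applies to both products.\<close>
  moreover have "C_k k f" "C_k k g" using Suc.prems by (blast dest: C_k_SucD)+
  ultimately show ?case using Suc d by (auto intro!: C_k_add)
qed

lemma smooth_const: "smooth (\<lambda>x. c)"
  by (simp add: smooth_def C_k_const)

lemma smooth_mult: "smooth f \<Longrightarrow> smooth g \<Longrightarrow> smooth (\<lambda>x. f x * g x)"
  by (simp add: smooth_def C_k_mult)

section \<open>The logistic function and its smoothness\<close>

definition logistic :: "real \<Rightarrow> real" where
  "logistic s = 1 / (1 + exp s)"

lemma logistic_bounds: "0 < logistic s" "logistic s < 1"
  by (auto simp: logistic_def add_pos_pos)

text \<open>Written as a polynomial in \<open>logistic s\<close> itself, the derivative lets
  smoothness be proved by induction without computing higher derivatives.\<close>

lemma has_real_derivative_logistic: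
  "(logistic has_real_derivative - (logistic s * (1 - logistic s))) (at s)"
proof -
  have "1 + exp s \<noteq> 0" by (smt (verit) exp_gt_zero)
  then show ?thesis
    unfolding logistic_def
    by (auto intro!: derivative_eq_intros simp: field_simps power2_eq_square)
qed

text \<open>By the logistic differential equation, every directional derivative is a polynomial in
  the function with constant coefficients, so class \<open>C_k k\<close> of the function gives class
  \<open>C_k (Suc k)\<close>.\<close>

lemma smooth_logistic_inner:
  fixes e :: "'a::real_inner"
  shows "smooth (\<lambda>x. logistic (a * (x \<bullet> e) + b))"
proof -
  let ?h = "\<lambda>x::'a. a * (x \<bullet> e) + b"
  have D: "((\<lambda>x. logistic (?h x)) has_derivative
      (\<lambda>v. - (logistic (?h x) * (1 - logistic (?h x))) * (a * (v \<bullet> e)))) (at x)" for x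
  proof -
    have "(?h has_derivative (\<lambda>v. a * (v \<bullet> e))) (at x)"
      by (auto intro!: derivative_eq_intros)
    from has_derivative_compose[OF this has_real_derivative_logistic[unfolded has_field_derivative_def]]
    show ?thesis by simp
  qed
  have "C_k k (\<lambda>x. logistic (?h x))" for k
  proof (induction k)
    case 0
    show ?case
      using D by (auto intro!: continuous_at_imp_continuous_on has_derivative_continuous)
  next
    case (Suc k)
    \<comment> \<open>The derivative is rearranged into sums and products of the function and
      constants, the shapes the closure lemmas handle; \<open>a * (v \<bullet> e)\<close> does not
      depend on \<open>x\<close>.\<close>
    have "C_k k (\<lambda>x. logistic (?h x) * (1 + (-1) * logistic (?h x)) * (- (a * (v \<bullet> e))))" for v
      by (intro C_k_mult C_k_add C_k_const Suc)
    then show ?case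
      using D by (auto simp: frechet_derivative_at[OF D, symmetric] differentiable_def)
  qed
  then show ?thesis by (simp add: smooth_def)
qed

section \<open>Bounds for the integrands\<close>

text \<open>The first bound is \<open>ln u \<le> u - 1\<close> at \<open>u = 1 / y\<close>. The
  second is the square of the first at \<open>sqrt y\<close>: since
  \<open>ln (sqrt y) = ln y / 2\<close>, the constant is 4.\<close>

lemma mult_ln_bounds:
  fixes y :: real
  assumes "0 < y" "y \<le> 1"
  shows "\<bar>y * ln y\<bar> \<le> 1" "\<bar>y * (ln y)\<^sup>2\<bar> \<le> 4"
proof -
  have *: "\<bar>z * ln z\<bar> \<le> 1" if "0 < z" "z \<le> 1" for z :: real
  proof -
    have "- ln z \<le> 1 / z - 1"
      using ln_le_minus_one[of "1 / z"] that by (simp add: ln_div)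
    then have "z * (- ln z) \<le> z * (1 / z - 1)"
      using that by (intro mult_left_mono) auto
    moreover have "z * ln z \<le> 0"
      using that by (simp add: mult_nonneg_nonpos)
    ultimately show ?thesis using that by (simp add: algebra_simps)
  qed
  show "\<bar>y * ln y\<bar> \<le> 1" using * assms by blast
  have "(sqrt y * ln (sqrt y))\<^sup>2 \<le> 1"
    using *[of "sqrt y"] assms by (simp add: abs_square_le_1)
  moreover have "(sqrt y * ln (sqrt y))\<^sup>2 = y * (ln y)\<^sup>2 / 4"
    using assms by (simp add: ln_sqrt power_mult_distrib power_divide)
  ultimately show "\<bar>y * (ln y)\<^sup>2\<bar> \<le> 4" using assms by simp
qed

lemma smooth_pos_density_measurable:
  "smooth_pos_density \<rho> \<Longrightarrow> \<rho> \<in> borel_measurable borel"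
  by (auto simp: smooth_pos_density_def has_bochner_integral_iff)

section \<open>Mass of half-spaces\<close>

text \<open>Dominated convergence with majorant \<open>norm (f x)\<close>: by the Archimedean
  property each point lies in all but finitely many of the half-spaces.\<close>

lemma integral_halfspace_tendsto:
  fixes f :: "'a::euclidean_space \<Rightarrow> real"
  assumes "integrable lborel f"
  shows "(\<lambda>n. \<integral>x. f x * indicator {x. x \<bullet> e < real n} x \<partial>lborel)
    \<longlonglongrightarrow> (\<integral>x. f x \<partial>lborel)"
proof (rule integral_dominated_convergence[where w = "\<lambda>x. norm (f x)"])
  have [measurable]: "f \<in> borel_measurable borel" using assms by auto
  show "(\<lambda>x. f x * indicator {x. x \<bullet> e < real n} x) \<in> borel_measurable lborel" for n
    by measurable
  show "AE x in lborel. (\<lambda>n. f x * indicator {x. x \<bullet> e < real n} x) \<longlonglongrightarrow> f x"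
  proof (rule AE_I2)
    fix x
    obtain N where "x \<bullet> e < real N" using reals_Archimedean2 by blast
    then have "eventually (\<lambda>n. f x * indicator {x. x \<bullet> e < real n} x = f x) sequentially"
      by (intro eventually_sequentiallyI[of N]) auto
    then show "(\<lambda>n. f x * indicator {x. x \<bullet> e < real n} x) \<longlonglongrightarrow> f x"
      by (rule tendsto_eventually)
  qed
qed (use assms in \<open>auto simp: indicator_def\<close>)

text \<open>Equality would force the positive \<open>f\<close> to vanish almost everywhere off the
  half-space, making the complement null, although it contains a nonempty open set.\<close>

lemma integral_halfspace_less:
  fixes f :: "'a::euclidean_space \<Rightarrow> real"
  assumes "integrable lborel f" "\<And>x. 0 < f x" "e \<noteq> 0"
  shows "(\<integral>x. f x * indicator {x. x \<bullet> e < t} x \<partial>lborel) < (\<integral>x. f x \<partial>lborel)"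
proof -
  have [measurable]: "f \<in> borel_measurable borel" using assms by auto
  let ?g = "\<lambda>x. f x * indicator {x. x \<bullet> e < t} x"
  have g: "integrable lborel ?g"
    by (rule Bochner_Integration.integrable_bound[OF assms(1)]) (auto simp: indicator_def)
  have le: "?g x \<le> f x" for x using assms(2)[of x] by (simp add: indicator_def)
  have "(\<integral>x. ?g x \<partial>lborel) \<le> (\<integral>x. f x \<partial>lborel)"
    using g assms(1) le by (rule integral_mono)
  moreover have "(\<integral>x. ?g x \<partial>lborel) \<noteq> (\<integral>x. f x \<partial>lborel)"
  proof
    assume "(\<integral>x. ?g x \<partial>lborel) = (\<integral>x. f x \<partial>lborel)"
    then have "(\<integral>x. f x - ?g x \<partial>lborel) = 0" using g assms(1) by simp
    then have "AE x in lborel. f x - ?g x = 0"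
      using g assms(1) le by (subst (asm) integral_nonneg_eq_0_iff_AE) auto
    then have "AE x in lborel. x \<bullet> e < t"
      by eventually_elim (auto simp: indicator_def assms(2) less_imp_neq[symmetric] split: if_splits)
    then have "emeasure lborel {x. \<not> x \<bullet> e < t} = 0"
      by (subst (asm) AE_iff_measurable[OF _ refl]) auto
    \<comment> \<open>Passing to the strict inequality gives an open subset of the null
      complement.\<close>
    moreover have "emeasure lborel {x. x \<bullet> e > t} \<le> emeasure lborel {x. \<not> x \<bullet> e < t}"
      by (rule emeasure_mono) auto
    ultimately have "negligible {x. x \<bullet> e > t}"
      by (auto simp: negligible_iff_emeasure0 emeasure_completion)
    moreover have "open {x. x \<bullet> e > t}"
      by (intro open_Collect_less continuous_intros)
    \<comment> \<open>The multiple of \<open>e\<close> is scaled so that its inner product with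
      \<open>e\<close> is \<open>t + 1\<close>.\<close>
    moreover have "((t + 1) / (e \<bullet> e)) *\<^sub>R e \<in> {x. x \<bullet> e > t}"
      using \<open>e \<noteq> 0\<close> by simp
    ultimately show False using open_not_negligible by blast
  qed
  ultimately show ?thesis by simp
qed

section \<open>Divergence and variance of a reweighted density\<close>

text \<open>In the log-ratio \<open>\<rho>s\<close> cancels and \<open>ln (\<phi> x) - ln z\<close>
  remains. Hence divergence and variance depend only on the three integrals \<open>z\<close>,
  \<open>k\<close>, \<open>q\<close>, whose integrands are \<open>\<rho>s\<close> times bounded
  functions.\<close>

lemma small_variance_of_weight:
  fixes \<rho>s \<phi> :: "'a::euclidean_space \<Rightarrow> real"
  assumes \<rho>s: "smooth_pos_density \<rho>s"
    and \<phi>: "smooth \<phi>" "\<phi> \<in> borel_measurable borel" "\<And>x. 0 < \<phi> x" "\<And>x. \<phi> x \<le> 1"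
  defines "z \<equiv> \<integral>x. \<rho>s x * \<phi> x \<partial>lborel"
    and "k \<equiv> \<integral>x. \<rho>s x * (\<phi> x * ln (\<phi> x)) \<partial>lborel"
    and "q \<equiv> \<integral>x. \<rho>s x * (\<phi> x * (ln (\<phi> x))\<^sup>2) \<partial>lborel"
  assumes z: "z > 0"
  defines "\<rho> \<equiv> \<lambda>x. \<rho>s x * \<phi> x * (1 / z)"
  shows "smooth_pos_density \<rho>"
    and "integrable lborel (\<lambda>x. \<rho> x * ln (\<rho> x / \<rho>s x))"
    and "KL \<rho> \<rho>s = k / z - ln z"
    and "integrable lborel (\<lambda>x. \<rho> x * (ln (\<rho> x / \<rho>s x) - KL \<rho> \<rho>s)\<^sup>2)"
    and "(\<integral>x. \<rho> x * (ln (\<rho> x / \<rho>s x) - KL \<rho> \<rho>s)\<^sup>2 \<partial>lborel) = q / z - (k / z)\<^sup>2"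
proof -
  note [measurable] = smooth_pos_density_measurable[OF \<rho>s] \<phi>(2)
  have \<rho>s_pos: "0 < \<rho>s x" for x using \<rho>s by (simp add: smooth_pos_density_def)
  have \<rho>s_int: "integrable lborel \<rho>s"
    using \<rho>s by (simp add: smooth_pos_density_def has_bochner_integral_iff)
  have bdd: "integrable lborel (\<lambda>x. \<rho>s x * g x)"
    if [measurable]: "g \<in> borel_measurable borel" and "\<And>x. \<bar>g x\<bar> \<le> B" for g B
  proof (rule Bochner_Integration.integrable_bound[where f = "\<lambda>x. B * \<rho>s x"])
    have "norm (\<rho>s x * g x) \<le> norm (B * \<rho>s x)" for x
    proof -
      have "\<rho>s x * \<bar>g x\<bar> \<le> \<rho>s x * \<bar>B\<bar>"
        using that(2)[of x] \<rho>s_pos[of x] by (intro mult_left_mono) auto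
      then show ?thesis using \<rho>s_pos[of x] by (simp add: abs_mult mult.commute)
    qed
    then show "AE x in lborel. norm (\<rho>s x * g x) \<le> norm (B * \<rho>s x)" by simp
    show "integrable lborel (\<lambda>x. B * \<rho>s x)" using \<rho>s_int by simp
  qed measurable
  have I: "integrable lborel (\<lambda>x. \<rho>s x * \<phi> x)"
    by (rule bdd[of _ 1]) (use \<phi> in \<open>simp_all add: less_imp_le\<close>)
  have I1: "integrable lborel (\<lambda>x. \<rho>s x * (\<phi> x * ln (\<phi> x)))"
    by (rule bdd[OF _ mult_ln_bounds(1)[OF \<phi>(3,4)]]) measurable
  have I2: "integrable lborel (\<lambda>x. \<rho>s x * (\<phi> x * (ln (\<phi> x))\<^sup>2))"
    by (rule bdd[OF _ mult_ln_bounds(2)[OF \<phi>(3,4)]]) measurable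
  have Z: "has_bochner_integral lborel (\<lambda>x. \<rho>s x * \<phi> x) z"
    and K: "has_bochner_integral lborel (\<lambda>x. \<rho>s x * (\<phi> x * ln (\<phi> x))) k"
    and Q: "has_bochner_integral lborel (\<lambda>x. \<rho>s x * (\<phi> x * (ln (\<phi> x))\<^sup>2)) q"
    unfolding z_def k_def q_def by (intro has_bochner_integral_integrable I I1 I2)+
  \<comment> \<open>Naming the quotients turns the identities below into polynomial ones, which
    \<open>algebra\<close> can settle.\<close>
  define r where "r = 1 / z"
  define c where "c = k / z"
  have \<rho>_eq: "\<rho> = (\<lambda>x. \<rho>s x * \<phi> x * r)" by (simp add: \<rho>_def r_def)
  have r: "0 < r" "z * r = 1" "k * r = c" "q / z = q * r" using z by (auto simp: r_def c_def)
  have "has_bochner_integral lborel \<rho> (z * r)"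
    unfolding \<rho>_eq by (intro has_bochner_integral_mult_left Z)
  moreover have "smooth \<rho>"
    unfolding \<rho>_eq using \<rho>s \<phi>(1)
    by (intro smooth_mult smooth_const) (simp_all add: smooth_pos_density_def)
  ultimately show "smooth_pos_density \<rho>"
    using \<rho>s_pos \<phi>(3) r by (simp add: smooth_pos_density_def \<rho>_eq)
  have ratio: "ln (\<rho> x / \<rho>s x) = ln (\<phi> x) - ln z" for x
    using \<rho>s_pos[of x] \<phi>(3)[of x] z by (simp add: \<rho>_def ln_div)
  have e1: "(\<lambda>x. \<rho> x * ln (\<rho> x / \<rho>s x))
      = (\<lambda>x. (\<rho>s x * (\<phi> x * ln (\<phi> x))) * r - (\<rho>s x * \<phi> x) * (ln z * r))"
    unfolding ratio unfolding \<rho>_eq by (rule ext) algebra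
  have H1: "has_bochner_integral lborel (\<lambda>x. \<rho> x * ln (\<rho> x / \<rho>s x)) (k * r - z * (ln z * r))"
    unfolding e1 by (intro has_bochner_integral_diff has_bochner_integral_mult_left Z K)
  then show "integrable lborel (\<lambda>x. \<rho> x * ln (\<rho> x / \<rho>s x))"
    by (rule integrable.intros)
  have "k * r - z * (ln z * r) = c - ln z" using r(2,3) by algebra
  with H1 have KL: "KL \<rho> \<rho>s = c - ln z"
    unfolding KL_def by (metis has_bochner_integral_integral_eq)
  then show "KL \<rho> \<rho>s = k / z - ln z" by (simp add: c_def)
  \<comment> \<open>The terms \<open>ln z\<close> cancel in the deviation from the mean, which is
    \<open>ln (\<phi> x) - c\<close>; its square is expanded.\<close>
  have e2: "(\<lambda>x. \<rho> x * (ln (\<rho> x / \<rho>s x) - KL \<rho> \<rho>s)\<^sup>2)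
      = (\<lambda>x. (\<rho>s x * (\<phi> x * (ln (\<phi> x))\<^sup>2)) * r
          - (\<rho>s x * (\<phi> x * ln (\<phi> x))) * (2 * c * r) + (\<rho>s x * \<phi> x) * (c\<^sup>2 * r))"
    unfolding ratio KL unfolding \<rho>_eq by (rule ext) algebra
  have H2: "has_bochner_integral lborel (\<lambda>x. \<rho> x * (ln (\<rho> x / \<rho>s x) - KL \<rho> \<rho>s)\<^sup>2)
      (q * r - k * (2 * c * r) + z * (c\<^sup>2 * r))"
    unfolding e2
    by (intro has_bochner_integral_add has_bochner_integral_diff has_bochner_integral_mult_left Z K Q)
  then show "integrable lborel (\<lambda>x. \<rho> x * (ln (\<rho> x / \<rho>s x) - KL \<rho> \<rho>s)\<^sup>2)"
    by (rule integrable.intros)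
  \<comment> \<open>With \<open>k * r = c\<close> and \<open>z * r = 1\<close> this is second moment
    minus squared mean.\<close>
  have "q * r - k * (2 * c * r) + z * (c\<^sup>2 * r) = q / z - c\<^sup>2" using r(2,3,4) by algebra
  with H2 show "(\<integral>x. \<rho> x * (ln (\<rho> x / \<rho>s x) - KL \<rho> \<rho>s)\<^sup>2 \<partial>lborel) = q / z - (k / z)\<^sup>2"
    by (simp add: has_bochner_integral_integral_eq c_def)
qed

section \<open>Passage to the limit and choice of the density\<close>

text \<open>The shift \<open>ln (n + 1)\<close> makes the limit \<open>0\<close> on the boundary hyperplane too.\<close>

lemma logistic_tendsto:
  "s < 0 \<Longrightarrow> (\<lambda>n. logistic (real n * s + ln (real n + 1))) \<longlonglongrightarrow> 1"
  "s \<ge> 0 \<Longrightarrow> filterlim (\<lambda>n. logistic (real n * s + ln (real n + 1))) (at_right 0) sequentially"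
proof -
  show "(\<lambda>n. logistic (real n * s + ln (real n + 1))) \<longlonglongrightarrow> 1" if "s < 0"
    unfolding logistic_def using that by real_asymp
  assume "s \<ge> 0"
  then consider "s = 0" | "s > 0" by linarith
  then have "(\<lambda>n. logistic (real n * s + ln (real n + 1))) \<longlonglongrightarrow> 0"
  proof cases
    case 1
    show ?thesis unfolding logistic_def 1 by real_asymp
  next
    case 2
    then show ?thesis unfolding logistic_def by real_asymp
  qed
  \<comment> \<open>Convergence to 0 becomes convergence from the right because logistic values are
    positive.\<close>
  then show "filterlim (\<lambda>n. logistic (real n * s + ln (real n + 1))) (at_right 0) sequentially"
    by (auto simp: filterlim_at logistic_bounds(1) less_imp_neq[symmetric])
qed

text \<open>The half-space is fixed first, so that its limiting divergence lies strictly between 0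
  and \<open>\<epsilon>'\<close>. All required inequalities are then strict in the limit and hold
  together for some large \<open>n\<close>.\<close>

lemma exists_small_variance:
  fixes \<rho>s :: "'a::euclidean_space \<Rightarrow> real"
  assumes \<rho>s: "smooth_pos_density \<rho>s" and "\<epsilon> > 0" "\<epsilon>' > 0"
  shows "\<exists>\<rho>. smooth_pos_density \<rho> \<and> \<rho> \<noteq> \<rho>s \<and>
        integrable lborel (\<lambda>\<theta>. \<rho> \<theta> * ln (\<rho> \<theta> / \<rho>s \<theta>)) \<and>
        integrable lborel (\<lambda>\<theta>. \<rho> \<theta> * (ln (\<rho> \<theta> / \<rho>s \<theta>) - KL \<rho> \<rho>s)\<^sup>2) \<and>
        (\<integral>\<theta>. \<rho> \<theta> * (ln (\<rho> \<theta> / \<rho>s \<theta>) - KL \<rho> \<rho>s)\<^sup>2 \<partial>lborel) \<le> \<epsilon> * KL \<rho> \<rho>s \<and>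
        KL \<rho> \<rho>s < \<epsilon>'"
proof -
  note [measurable] = smooth_pos_density_measurable[OF \<rho>s]
  have \<rho>s_pos: "0 < \<rho>s x" for x using \<rho>s by (simp add: smooth_pos_density_def)
  have \<rho>s_int: "integrable lborel \<rho>s" "(\<integral>x. \<rho>s x \<partial>lborel) = 1"
    using \<rho>s by (auto simp: smooth_pos_density_def has_bochner_integral_iff)
  obtain e :: 'a where e: "e \<in> Basis" using nonempty_Basis by blast
  define P where "P t = (\<integral>x. \<rho>s x * indicator {x. x \<bullet> e < t} x \<partial>lborel)" for t
  have "(\<lambda>n. P (real n)) \<longlonglongrightarrow> 1"
    using integral_halfspace_tendsto[OF \<rho>s_int(1), of e] by (simp add: P_def \<rho>s_int)
  \<comment> \<open>This threshold is the one for which \<open>P t > exp (- \<epsilon>')\<close>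
    means \<open>- ln (P t) < \<epsilon>'\<close>.\<close>
  moreover have "exp (- \<epsilon>') < 1" using \<open>\<epsilon>' > 0\<close> by simp
  ultimately have "eventually (\<lambda>n. P (real n) > exp (- \<epsilon>')) sequentially"
    by (rule order_tendstoD)
  then obtain t where t: "P t > exp (- \<epsilon>')"
    by (auto simp: eventually_sequentially)
  have P0: "P t > 0" using t exp_gt_zero[of "- \<epsilon>'"] by linarith
  have P1: "P t < 1"
    using integral_halfspace_less[OF \<rho>s_int(1) \<rho>s_pos, of e t] nonzero_Basis[OF e]
    by (simp add: P_def \<rho>s_int)
  have "- \<epsilon>' < ln (P t)" using t P0 by (metis exp_less_cancel_iff exp_ln)
  then have lnP: "- ln (P t) < \<epsilon>'" by simp

  define \<phi> where "\<phi> n x = logistic (real n * (x \<bullet> e - t) + ln (real n + 1))" for n x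
  have \<phi>: "0 < \<phi> n x" "\<phi> n x \<le> 1" for n x
    using logistic_bounds[of "real n * (x \<bullet> e - t) + ln (real n + 1)"] by (auto simp: \<phi>_def)
  have \<phi>_smooth: "smooth (\<phi> n)" for n
    using smooth_logistic_inner[of "real n" e "- real n * t + ln (real n + 1)"]
    by (simp add: \<phi>_def[abs_def] algebra_simps)
  have \<phi>_meas[measurable]: "\<phi> n \<in> borel_measurable borel" for n
    unfolding \<phi>_def[abs_def] logistic_def by measurable
  \<comment> \<open>One limit statement serves \<open>z\<close>, \<open>k\<close> and
    \<open>q\<close>, with \<open>h y\<close> equal to \<open>y\<close>, \<open>y * ln y\<close> and
    \<open>y * (ln y)\<^sup>2\<close>. Inside the half-space \<open>h\<close> is evaluated near 1,
    elsewhere near 0 from the right. The last two choices vanish at 1, so \<open>k\<close> and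
    \<open>q\<close> tend to 0.\<close>
  have lim: "(\<lambda>n. \<integral>x. \<rho>s x * h (\<phi> n x) \<partial>lborel) \<longlonglongrightarrow> h 1 * P t"
    if [measurable]: "h \<in> borel_measurable borel"
      and B: "\<And>y. 0 < y \<Longrightarrow> y \<le> 1 \<Longrightarrow> \<bar>h y\<bar> \<le> B"
      and h0: "(h \<longlongrightarrow> 0) (at_right 0)" and h1: "isCont h 1" for h :: "real \<Rightarrow> real" and B
  proof -
    let ?l = "\<lambda>x. h 1 * (\<rho>s x * indicator {x. x \<bullet> e < t} x)"
    have "(\<lambda>n. \<integral>x. \<rho>s x * h (\<phi> n x) \<partial>lborel) \<longlonglongrightarrow> (\<integral>x. ?l x \<partial>lborel)"
    proof (rule integral_dominated_convergence[where w = "\<lambda>x. B * \<rho>s x"])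
      show "AE x in lborel. (\<lambda>n. \<rho>s x * h (\<phi> n x)) \<longlonglongrightarrow> ?l x"
      proof (rule AE_I2)
        fix x
        show "(\<lambda>n. \<rho>s x * h (\<phi> n x)) \<longlonglongrightarrow> ?l x"
        proof (cases "x \<bullet> e < t")
          case True
          then have "(\<lambda>n. h (\<phi> n x)) \<longlonglongrightarrow> h 1"
            unfolding \<phi>_def by (intro isCont_tendsto_compose[OF h1] logistic_tendsto) simp
          from tendsto_mult_left[OF this, of "\<rho>s x"] True show ?thesis by (simp add: mult.commute)
        next
          case False
          then have "(\<lambda>n. h (\<phi> n x)) \<longlonglongrightarrow> 0"
            unfolding \<phi>_def by (intro filterlim_compose[OF h0] logistic_tendsto) simp
          from tendsto_mult_left[OF this, of "\<rho>s x"] False show ?thesis by simp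
        qed
      qed
      show "AE x in lborel. norm (\<rho>s x * h (\<phi> n x)) \<le> B * \<rho>s x" for n
        using B[OF \<phi>] \<rho>s_pos by (auto simp: abs_mult less_imp_le mult.commute)
    qed (use \<rho>s_int in auto)
    then show ?thesis by (simp add: P_def)
  qed

  define z where "z n = (\<integral>x. \<rho>s x * \<phi> n x \<partial>lborel)" for n
  define k where "k n = (\<integral>x. \<rho>s x * (\<phi> n x * ln (\<phi> n x)) \<partial>lborel)" for n
  define q where "q n = (\<integral>x. \<rho>s x * (\<phi> n x * (ln (\<phi> n x))\<^sup>2) \<partial>lborel)" for n
  have z: "z \<longlonglongrightarrow> P t"
    using lim[of "\<lambda>y. y" 1] by (simp add: z_def[abs_def] tendsto_ident_at)
  have "((\<lambda>y. y * ln y) \<longlongrightarrow> 0) (at_right (0::real))" by real_asymp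
  from lim[of "\<lambda>y. y * ln y", OF _ mult_ln_bounds(1) this] have k: "k \<longlonglongrightarrow> 0"
    by (simp add: k_def[abs_def] continuous_intros)
  have "((\<lambda>y. y * (ln y)\<^sup>2) \<longlongrightarrow> 0) (at_right (0::real))" by real_asymp
  from lim[of "\<lambda>y. y * (ln y)\<^sup>2", OF _ mult_ln_bounds(2) this] have q: "q \<longlonglongrightarrow> 0"
    by (simp add: q_def[abs_def] continuous_intros)
  have KL_lim: "(\<lambda>n. k n / z n - ln (z n)) \<longlonglongrightarrow> - ln (P t)"
    using tendsto_diff[OF tendsto_divide[OF k z] tendsto_ln[OF z]] P0 by simp
  \<comment> \<open>Subtracting \<open>\<epsilon>\<close> times the divergence reduces the claim to
    a sign: the limit equals \<open>\<epsilon> * ln (P t)\<close>, which is negative.\<close>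
  have var_lim: "(\<lambda>n. q n / z n - (k n / z n)\<^sup>2 - \<epsilon> * (k n / z n - ln (z n)))
      \<longlonglongrightarrow> 0 / P t - (0 / P t)\<^sup>2 - \<epsilon> * (- ln (P t))"
    using P0 by (intro tendsto_intros q k z KL_lim) auto
  have "ln (P t) < 0" using P0 P1 by simp
  then have "0 / P t - (0 / P t)\<^sup>2 - \<epsilon> * (- ln (P t)) < 0"
    using \<open>\<epsilon> > 0\<close> by (simp add: mult_pos_neg)
  from order_tendstoD(2)[OF var_lim this] order_tendstoD(2)[OF KL_lim lnP]
    order_tendstoD(1)[OF KL_lim, of 0, simplified, OF \<open>ln (P t) < 0\<close>] order_tendstoD(1)[OF z P0]
  have "eventually (\<lambda>n. z n > 0 \<and> k n / z n - ln (z n) < \<epsilon>' \<and> 0 < k n / z n - ln (z n) \<and>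
      q n / z n - (k n / z n)\<^sup>2 \<le> \<epsilon> * (k n / z n - ln (z n))) sequentially"
    by eventually_elim simp
  then obtain n where n: "z n > 0" "k n / z n - ln (z n) < \<epsilon>'" "0 < k n / z n - ln (z n)"
      "q n / z n - (k n / z n)\<^sup>2 \<le> \<epsilon> * (k n / z n - ln (z n))"
    by (auto simp: eventually_sequentially)
  obtain \<rho> where *: "smooth_pos_density \<rho>"
      "integrable lborel (\<lambda>x. \<rho> x * ln (\<rho> x / \<rho>s x))"
      "KL \<rho> \<rho>s = k n / z n - ln (z n)"
      "integrable lborel (\<lambda>x. \<rho> x * (ln (\<rho> x / \<rho>s x) - KL \<rho> \<rho>s)\<^sup>2)"
      "(\<integral>x. \<rho> x * (ln (\<rho> x / \<rho>s x) - KL \<rho> \<rho>s)\<^sup>2 \<partial>lborel) = q n / z n - (k n / z n)\<^sup>2"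
    using small_variance_of_weight[OF \<rho>s \<phi>_smooth \<phi>_meas \<phi>, of n, folded z_def k_def q_def, OF n(1)]
    by (rule that)
  \<comment> \<open>A positive divergence therefore separates \<open>\<rho>\<close> from
    \<open>\<rho>s\<close>.\<close>
  have "KL \<rho>s \<rho>s = 0" using \<rho>s_pos by (simp add: KL_def less_imp_neq[symmetric])
  then have "\<rho> \<noteq> \<rho>s" using *(3) n(3) by auto
  moreover have "(\<integral>x. \<rho> x * (ln (\<rho> x / \<rho>s x) - KL \<rho> \<rho>s)\<^sup>2 \<partial>lborel) \<le> \<epsilon> * KL \<rho> \<rho>s"
    unfolding *(5) unfolding *(3) by (rule n(4))
  moreover have "KL \<rho> \<rho>s < \<epsilon>'" unfolding *(3) by (rule n(2))
  ultimately show ?thesis using *(1,2,4) by (intro exI[of _ \<rho>] conjI)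
qed

theorem theorem4p1:
  fixes \<rho>s :: "real ^ 'n \<Rightarrow> real" and \<epsilon> :: real
  assumes "smooth_pos_density \<rho>s" and "\<epsilon> > 0"
  shows
    "(\<exists>\<rho>. smooth_pos_density \<rho> \<and> \<rho> \<noteq> \<rho>s \<and>
        integrable lborel (\<lambda>\<theta>. \<rho> \<theta> * ln (\<rho> \<theta> / \<rho>s \<theta>)) \<and>
        integrable lborel (\<lambda>\<theta>. \<rho> \<theta> * (ln (\<rho> \<theta> / \<rho>s \<theta>) - KL \<rho> \<rho>s)\<^sup>2) \<and>
        (\<integral>\<theta>. \<rho> \<theta> * (ln (\<rho> \<theta> / \<rho>s \<theta>) - KL \<rho> \<rho>s)\<^sup>2 \<partial>lborel) \<le> \<epsilon> * KL \<rho> \<rho>s)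
     \<and> (\<forall>\<epsilon>'>0. \<exists>\<rho>. smooth_pos_density \<rho> \<and> \<rho> \<noteq> \<rho>s \<and>
        integrable lborel (\<lambda>\<theta>. \<rho> \<theta> * ln (\<rho> \<theta> / \<rho>s \<theta>)) \<and>
        integrable lborel (\<lambda>\<theta>. \<rho> \<theta> * (ln (\<rho> \<theta> / \<rho>s \<theta>) - KL \<rho> \<rho>s)\<^sup>2) \<and>
        (\<integral>\<theta>. \<rho> \<theta> * (ln (\<rho> \<theta> / \<rho>s \<theta>) - KL \<rho> \<rho>s)\<^sup>2 \<partial>lborel) \<le> \<epsilon> * KL \<rho> \<rho>s \<and>
        KL \<rho> \<rho>s < \<epsilon>')"
proof (intro conjI allI impI)
  show "\<exists>\<rho>. smooth_pos_density \<rho> \<and> \<rho> \<noteq> \<rho>s \<and>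
        integrable lborel (\<lambda>\<theta>. \<rho> \<theta> * ln (\<rho> \<theta> / \<rho>s \<theta>)) \<and>
        integrable lborel (\<lambda>\<theta>. \<rho> \<theta> * (ln (\<rho> \<theta> / \<rho>s \<theta>) - KL \<rho> \<rho>s)\<^sup>2) \<and>
        (\<integral>\<theta>. \<rho> \<theta> * (ln (\<rho> \<theta> / \<rho>s \<theta>) - KL \<rho> \<rho>s)\<^sup>2 \<partial>lborel) \<le> \<epsilon> * KL \<rho> \<rho>s"
    \<comment> \<open>The first claim is the second with radius 1, its last conjunct
      dropped.\<close>
    by (rule ex_forward[OF exists_small_variance[OF assms zero_less_one]]) (elim conjE, intro conjI)
qed (rule exists_small_variance[OF assms])

end
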